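(* (a) There exist a determined Abelian topological group $G$ and an open-and-closed subgroup $H$ of $G$ such that $H$ is not determined. (b) There exist locally bounded Hausdorff Abelian topological groups which are not totally bounded, not metrizable, and determined.
   Context: All groups are Abelian. $\mathbb T$ is the circle group, $(-\tfrac12,\tfrac12]$ with addition mod $1$ and its usual compact metrizable topology. For a topological Abelian group $G$, $\widehat G$ is the group of continuous homomorphisms $G\to\mathbb T$ with the compact-open topology. A dense subgroup $D$ of $G$ determines $G$ if the restriction map $\widehat G\to\widehat D$, $h\mapsto h|D$ (which is always a continuous group isomorphism) is a homeomorphism. $G$ is determined if every dense subgroup of $G$ determines $G$. A subset $S$ of $G$ is bounded in $G$ if for every nonempty open $V\subseteq G$ there is a finite $F\subseteq G$ with $S\subseteq F+V$; $G$ is locally bounded if some nonempty open subset of $G$ is bounded, and totally bounded if $G$ itself is bounded in $G$. *)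

theory Defs
  imports "HOL-Analysis.Analysis" "HOL-Algebra.Coset"
begin

text \<open>
  Groups are written multiplicatively, as in HOL-Algebra; a topological group is a group
  together with a topology on its carrier.
\<close>

locale topological_comm_group = comm_group G for G (structure) and X +
  assumes topspace_eq: "topspace X = carrier G"
    and continuous_mult: "continuous_map (prod_topology X X) X (\<lambda>(x, y). x \<otimes> y)"
    and continuous_inv: "continuous_map X X (\<lambda>x. inv x)"

abbreviation subgroup_of :: "'a monoid \<Rightarrow> 'a set \<Rightarrow> 'a monoid" where
  "subgroup_of G D \<equiv> G\<lparr>carrier := D\<rparr>"


subsection \<open>The circle group\<close>

text \<open>The representative of \<^term>\<open>x\<close> modulo 1 in the interval \<open>(-1/2, 1/2]\<close>.\<close>

definition circle_rep :: "real \<Rightarrow> real" where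
  "circle_rep x = x - of_int \<lceil>x - 1/2\<rceil>"

definition circle_group :: "real monoid" where
  "circle_group =
     \<lparr>carrier = {-1/2<..1/2}, mult = (\<lambda>x y. circle_rep (x + y)), one = 0\<rparr>"

text \<open>
  The topology is not the subspace topology of the half-open interval: the two ends are glued.
  It is the one transported from the unit circle along the bijection \<open>x \<mapsto> exp(2\<pi>ix)\<close>.
\<close>

definition circle_topology :: "real topology" where
  "circle_topology = pullback_topology {-1/2<..1/2} (\<lambda>x. cis (2 * pi * x)) euclidean"


subsection \<open>The dual group\<close>

text \<open>
  Characters are taken to be \<^const>\<open>extensional\<close>, so that each of them is represented by exactly
  one function.
\<close>

definition dual_group :: "'a monoid \<Rightarrow> 'a topology \<Rightarrow> ('a \<Rightarrow> real) monoid" where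
  "dual_group G X =
     \<lparr>carrier = {h \<in> hom G circle_group \<inter> extensional (carrier G).
                  continuous_map X circle_topology h},
      mult = (\<lambda>h k. \<lambda>x\<in>carrier G. h x \<otimes>\<^bsub>circle_group\<^esub> k x),
      one = (\<lambda>x\<in>carrier G. \<one>\<^bsub>circle_group\<^esub>)\<rparr>"

text \<open>
  The compact-open topology; the choice \<open>K = {}\<close> shows that the subbase covers the dual group.
\<close>

definition dual_topology :: "'a monoid \<Rightarrow> 'a topology \<Rightarrow> ('a \<Rightarrow> real) topology" where
  "dual_topology G X =
     topology_generated_by
       {{h \<in> carrier (dual_group G X). h ` K \<subseteq> U} | K U.
          compactin X K \<and> openin circle_topology U}"


subsection \<open>Determined groups\<close>

definition determines :: "'a set \<Rightarrow> 'a monoid \<Rightarrow> 'a topology \<Rightarrow> bool" where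
  "determines D G X \<longleftrightarrow>
     homeomorphic_map (dual_topology G X)
                      (dual_topology (subgroup_of G D) (subtopology X D))
                      (\<lambda>h. restrict h D)"

definition determined :: "'a monoid \<Rightarrow> 'a topology \<Rightarrow> bool" where
  "determined G X \<longleftrightarrow>
     (\<forall>D. subgroup D G \<and> X closure_of D = topspace X \<longrightarrow> determines D G X)"


subsection \<open>Boundedness\<close>

definition bounded_in :: "'a monoid \<Rightarrow> 'a topology \<Rightarrow> 'a set \<Rightarrow> bool" where
  "bounded_in G X S \<longleftrightarrow>
     S \<subseteq> carrier G \<and>
     (\<forall>V. openin X V \<and> V \<noteq> {} \<longrightarrow>
        (\<exists>F. finite F \<and> F \<subseteq> carrier G \<and> S \<subseteq> F <#>\<^bsub>G\<^esub> V))"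

definition locally_bounded_group :: "'a monoid \<Rightarrow> 'a topology \<Rightarrow> bool" where
  "locally_bounded_group G X \<longleftrightarrow> (\<exists>U. openin X U \<and> U \<noteq> {} \<and> bounded_in G X U)"

definition totally_bounded_group :: "'a monoid \<Rightarrow> 'a topology \<Rightarrow> bool" where
  "totally_bounded_group G X \<longleftrightarrow> bounded_in G X (carrier G)"

end

theory Submission
  imports Defs
begin

text \<open>
  One group serves for both parts. The driving observation is that a topological group in which every
  element is a square (in additive language, a group divisible by 2) and which has an open subgroup \<open>H\<close>
  of exponent 2 has no proper dense subgroup, and is therefore determined no matter what \<open>H\<close> looks like
  (\<open>determined_if_open_subgroup_of_involutions\<close>). So it suffices to find a compact group \<open>H\<close> of exponent
  2 that is not determined, embed it in a group with square roots, and declare it open there.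

  For \<open>H\<close> take the Bohr compactification of a countably infinite vector space over the field with two
  elements, realised by the finite sets of naturals under symmetric difference. Its functionals are
  given by all sets \<open>S\<close> of naturals through the parity of the intersection with \<open>S\<close>, so the vector space
  becomes a subgroup \<open>parities\<close> of a power of the cyclic group of order 2, indexed by the sets of
  naturals, and \<open>H\<close> is its closure there. The compact subsets of \<open>parities\<close> are finite
  (\<open>finite_if_compactin_parities\<close>). Hence the dual of \<open>parities\<close> carries the topology of pointwise
  convergence, which is not discrete, whereas the dual of the compact group \<open>H\<close> is discrete: \<open>H\<close> is not
  determined (\<open>H_not_determined\<close>).

  Replacing the cyclic group of order 2 by the rationals modulo 1 embeds the power in one that has
  square roots. This larger power, with \<open>H\<close> made open, is the required group. It is locally bounded
  because \<open>H\<close> is a compact open subgroup, and not totally bounded because \<open>H\<close> has infinite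
  index: squaring is constant on the cosets of \<open>H\<close> and its values are all the elements of the group.
  It is not metrizable, since otherwise \<open>parities\<close>, which has no isolated point, would contain a
  nontrivial convergent sequence and with it an infinite compact set.
\<close>

section \<open>Groups with an open subgroup of exponent 2\<close>

lemma determines_carrier:
  assumes "topspace X = carrier G"
  shows "determines (carrier G) G X"
proof -
  have "topspace (dual_topology G X) \<subseteq> carrier (dual_group G X)"
    by (auto simp: dual_topology_def)
  then have "topspace (dual_topology G X) \<subseteq> extensional (carrier G)"
    by (auto simp: dual_group_def)
  then have "homeomorphic_map (dual_topology G X) (dual_topology G X) (\<lambda>h. restrict h (carrier G))"
    by (intro homeomorphic_map_eq[OF homeomorphic_map_id[THEN iffD2, OF refl]])
      (auto simp: extensional_restrict)
  moreover have "subtopology X (carrier G) = X"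
    using assms subtopology_topspace by metis
  ultimately show ?thesis
    by (simp add: determines_def)
qed

context topological_comm_group
begin

lemma continuous_map_translation:
  assumes "a \<in> carrier G"
  shows "continuous_map X X (\<lambda>x. a \<otimes> x)"
proof -
  have "continuous_map X (prod_topology X X) (\<lambda>x. (a, x))"
    using assms by (simp add: continuous_map_pairedI topspace_eq)
  from continuous_map_compose[OF this continuous_mult] show ?thesis
    by (simp add: o_def)
qed

lemma openin_translate:
  assumes "a \<in> carrier G" "openin X U"
  shows "openin X {x \<in> carrier G. inv a \<otimes> x \<in> U}"
  using openin_continuous_map_preimage[OF continuous_map_translation[of "inv a"] assms(2)] assms(1)
  by (simp add: topspace_eq)

lemma subgroup_closure_of:
  assumes "subgroup D G"
  shows "subgroup (X closure_of D) G"
proof (rule subgroupI)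
  interpret D: subgroup D G by fact
  show "X closure_of D \<subseteq> carrier G"
    using closure_of_subset_topspace[of X D] topspace_eq by auto
  have "D \<subseteq> X closure_of D"
    using D.subset topspace_eq by (simp add: closure_of_subset)
  then show "X closure_of D \<noteq> {}"
    using subgroup.one_closed[OF assms] by blast
  show "inv a \<in> X closure_of D" if "a \<in> X closure_of D" for a
  proof -
    have "(\<lambda>x. inv x) ` (X closure_of D) \<subseteq> X closure_of ((\<lambda>x. inv x) ` D)"
      by (rule continuous_map_image_closure_subset[OF continuous_inv])
    also have "\<dots> \<subseteq> X closure_of D"
      by (rule closure_of_mono) auto
    finally show ?thesis using that by auto
  qed
  show "a \<otimes> b \<in> X closure_of D" if "a \<in> X closure_of D" "b \<in> X closure_of D" for a b
  proof -
    have "(\<lambda>(x, y). x \<otimes> y) ` (prod_topology X X closure_of (D \<times> D))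
        \<subseteq> X closure_of ((\<lambda>(x, y). x \<otimes> y) ` (D \<times> D))"
      by (rule continuous_map_image_closure_subset[OF continuous_mult])
    also have "\<dots> \<subseteq> X closure_of D"
      by (rule closure_of_mono) auto
    finally show ?thesis using that by (auto simp: closure_of_Times)
  qed
qed

end

context
  fixes G :: "'a monoid" (structure) and X
  assumes topological_group: "topological_comm_group G X"
begin

interpretation topological_comm_group G X
  by (fact topological_group)

text \<open>
  Every point of the compact set lies in some translate of the given open set, so finitely many
  translates suffice.
\<close>

lemma compactin_imp_bounded_in:
  assumes S: "compactin X S"
  shows "bounded_in G X S"
  unfolding bounded_in_def
proof (intro conjI allI impI)
  show Sc: "S \<subseteq> carrier G"
    using compactin_subset_topspace[OF S] topspace_eq by simp
  fix V assume "openin X V \<and> V \<noteq> {}"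
  then obtain v where V: "openin X V" and v: "v \<in> V" by auto
  have Vc: "V \<subseteq> carrier G" using openin_subset[OF V] topspace_eq by simp
  let ?T = "\<lambda>a. {x \<in> carrier G. inv a \<otimes> x \<in> V}"
  have "s \<in> ?T (s \<otimes> inv v)" if "s \<in> S" for s
  proof -
    have "s \<in> carrier G" "v \<in> carrier G" using that Sc v Vc by auto
    then have "inv (s \<otimes> inv v) \<otimes> s = v"
      by (simp add: inv_mult_group m_assoc)
    with \<open>s \<in> carrier G\<close> show ?thesis using v by simp
  qed
  moreover have "s \<otimes> inv v \<in> carrier G" if "s \<in> S" for s
    using that Sc v Vc by auto
  ultimately have cov: "S \<subseteq> \<Union>(?T ` carrier G)"
    by blast
  have "\<And>U. U \<in> ?T ` carrier G \<Longrightarrow> openin X U"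
    using openin_translate[OF _ V] by auto
  then obtain \<F> where "finite \<F>" "\<F> \<subseteq> ?T ` carrier G" "S \<subseteq> \<Union>\<F>"
    using S cov unfolding compactin_def by meson
  then obtain F where F: "finite F" "F \<subseteq> carrier G" "S \<subseteq> \<Union>(?T ` F)"
    by (metis (no_types, lifting) finite_subset_image)
  have "S \<subseteq> F <#> V"
  proof
    fix s assume "s \<in> S"
    then obtain a where a: "a \<in> F" "s \<in> carrier G" "inv a \<otimes> s \<in> V"
      using F(3) by auto
    moreover have "s = a \<otimes> (inv a \<otimes> s)"
      using a F(2) by (simp add: m_assoc[symmetric] subset_iff)
    ultimately show "s \<in> F <#> V"
      unfolding set_mult_def by blast
  qed
  with F show "\<exists>F. finite F \<and> F \<subseteq> carrier G \<and> S \<subseteq> F <#> V"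
    by blast
qed

text \<open>
  Such a group is determined for want of proper dense subgroups. A dense subgroup \<open>D\<close> meets every
  coset of the open subgroup \<open>H\<close>; since squaring kills \<open>H\<close>, each element that has a square root
  \<open>x\<close> is also the square of any element of \<open>D\<close> in the coset of \<open>x\<close>. If all elements have square
  roots, then \<open>D\<close> is the whole group.
\<close>

lemma determined_if_open_subgroup_of_involutions:
  assumes H: "openin X H" "subgroup H G"
    and two: "\<And>h. h \<in> H \<Longrightarrow> h \<otimes> h = \<one>"
    and root: "\<And>g. g \<in> carrier G \<Longrightarrow> \<exists>x\<in>carrier G. x \<otimes> x = g"
  shows "determined G X"
  unfolding determined_def
proof (intro allI impI, elim conjE)
  fix D assume D: "subgroup D G" and dense: "X closure_of D = topspace X"
  interpret D: subgroup D G by fact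
  interpret H: subgroup H G by fact
  have "g \<in> D" if g: "g \<in> carrier G" for g
  proof -
    obtain x where x: "x \<in> carrier G" "x \<otimes> x = g" using root[OF g] by auto
    let ?U = "{y \<in> carrier G. inv x \<otimes> y \<in> H}"
    have "x \<in> X closure_of D" "x \<in> ?U"
      using dense x(1) topspace_eq by simp_all
    then have "\<exists>y. y \<in> D \<and> y \<in> ?U"
      using openin_translate[OF x(1) H(1)] in_closure_of[of x X D] by meson
    then obtain y where y: "y \<in> D" "inv x \<otimes> y \<in> H"
      by auto
    define h where "h = inv x \<otimes> y"
    have h: "h \<in> H" "h \<in> carrier G" using y by (auto simp: h_def)
    have "y = x \<otimes> h"
      using x(1) y(1) by (simp add: h_def m_assoc[symmetric])
    then have "y \<otimes> y = (x \<otimes> x) \<otimes> (h \<otimes> h)"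
      using x(1) h(2) by (simp add: m_ac)
    then have "y \<otimes> y = g"
      using two[OF h(1)] g x(2) by simp
    then show ?thesis using y(1) D.m_closed by metis
  qed
  then have "D = carrier G" using D.subset by auto
  then show "determines D G X" using determines_carrier[OF topspace_eq] by simp
qed

text \<open>
  If finitely many cosets of \<open>H\<close> covered the group, there would be only finitely many squares, because
  squaring is constant on each coset.
\<close>

lemma not_totally_bounded_if_open_subgroup_of_involutions:
  assumes H: "openin X H" "subgroup H G"
    and two: "\<And>h. h \<in> H \<Longrightarrow> h \<otimes> h = \<one>"
    and root: "\<And>g. g \<in> carrier G \<Longrightarrow> \<exists>x\<in>carrier G. x \<otimes> x = g"
    and inf: "infinite (carrier G)"
  shows "\<not> totally_bounded_group G X"
proof
  assume "totally_bounded_group G X"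
  moreover have "H \<noteq> {}" using subgroup.one_closed[OF H(2)] by auto
  ultimately obtain F where F: "finite F" "F \<subseteq> carrier G" "carrier G \<subseteq> F <#> H"
    using H(1) unfolding totally_bounded_group_def bounded_in_def by meson
  have "carrier G \<subseteq> (\<lambda>f. f \<otimes> f) ` F"
  proof
    fix g assume g: "g \<in> carrier G"
    obtain x where x: "x \<in> carrier G" "x \<otimes> x = g" using root[OF g] by auto
    then obtain f h where f: "f \<in> F" and h: "h \<in> H" and xfh: "x = f \<otimes> h"
      using F(3) unfolding set_mult_def by blast
    have c: "f \<in> carrier G" "h \<in> carrier G"
      using f F(2) h subgroup.subset[OF H(2)] by auto
    then have "x \<otimes> x = (f \<otimes> f) \<otimes> (h \<otimes> h)"
      by (simp add: xfh m_ac)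
    then have "g = f \<otimes> f"
      using two[OF h] c x(2) by simp
    with f show "g \<in> (\<lambda>f. f \<otimes> f) ` F" by blast
  qed
  with F(1) inf show False using finite_surj by blast
qed

end

section \<open>Making a subgroup open\<close>

text \<open>
  The coarsest topology finer than \<open>Y\<close> that makes the quotient map onto the discrete group of cosets
  of \<open>H\<close> continuous. It makes \<open>H\<close> open and leaves the topology of \<open>H\<close> unchanged. Writing it as one
  pullback reduces the continuity of a map into it to the continuity of two maps.
\<close>

definition opened_topology :: "'a monoid \<Rightarrow> 'a topology \<Rightarrow> 'a set \<Rightarrow> 'a topology" where
  "opened_topology G Y H =
     pullback_topology (carrier G) (\<lambda>g. (g, H #>\<^bsub>G\<^esub> g)) (prod_topology Y (discrete_topology UNIV))"

lemma continuous_map_opened_topology: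
  assumes "f \<in> topspace Z \<rightarrow> carrier G" "continuous_map Z Y f"
    and "continuous_map Z (discrete_topology UNIV) (\<lambda>z. H #>\<^bsub>G\<^esub> f z)"
  shows "continuous_map Z (opened_topology G Y H) f"
  unfolding opened_topology_def
proof (rule continuous_map_pullback')
  show "continuous_map Z (prod_topology Y (discrete_topology UNIV)) ((\<lambda>g. (g, H #>\<^bsub>G\<^esub> g)) \<circ> f)"
    using assms(2,3) by (simp add: continuous_map_pairwise o_def)
  show "topspace Z \<subseteq> f -` carrier G"
    using assms(1) by auto
qed

context
  fixes G :: "'a monoid" (structure) and X
  assumes topological_group: "topological_comm_group G X"
begin

interpretation topological_comm_group G X
  by (fact topological_group)

lemma topspace_opened [simp]: "topspace (opened_topology G X H) = carrier G"
  by (auto simp: opened_topology_def topspace_pullback_topology topspace_eq)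

lemma continuous_map_opened:
  "continuous_map (opened_topology G X H) (prod_topology X (discrete_topology UNIV)) (\<lambda>g. (g, H #> g))"
  using continuous_map_pullback[OF continuous_map_id, where A = "carrier G" and f = "\<lambda>g. (g, H #> g)"]
  by (simp add: opened_topology_def)

lemma continuous_map_opened_id: "continuous_map (opened_topology G X H) X (\<lambda>g. g)"
  using continuous_map_opened by (simp add: continuous_map_pairwise o_def)

lemma continuous_map_opened_coset:
  "continuous_map (opened_topology G X H) (discrete_topology UNIV) (\<lambda>g. H #> g)"
  using continuous_map_opened by (simp add: continuous_map_pairwise o_def)

lemma opened_topology_finer:
  assumes "openin X U"
  shows "openin (opened_topology G X H) U"
proof -
  have "openin (opened_topology G X H) {g \<in> carrier G. g \<in> U}"
    using openin_continuous_map_preimage[OF continuous_map_opened_id assms] by simp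
  moreover have "{g \<in> carrier G. g \<in> U} = U"
    using openin_subset[OF assms] topspace_eq by auto
  ultimately show ?thesis by simp
qed

lemma topological_comm_group_opened:
  assumes H: "subgroup H G"
  shows "topological_comm_group G (opened_topology G X H)"
proof
  let ?X = "opened_topology G X H"
  let ?P = "prod_topology ?X ?X"
  interpret H: normal H G by (rule subgroup_imp_normal[OF H])
  show "topspace ?X = carrier G" by simp
  have fst: "continuous_map ?P ?X fst" and snd: "continuous_map ?P ?X snd"
    by (rule continuous_map_fst continuous_map_snd)+
  have id2: "continuous_map ?P (prod_topology X X) (\<lambda>z. z)"
    using continuous_map_compose[OF fst continuous_map_opened_id]
      continuous_map_compose[OF snd continuous_map_opened_id]
    by (simp add: continuous_map_pairwise o_def)
  have cos2: "continuous_map ?P (discrete_topology (UNIV \<times> UNIV)) (\<lambda>z. (H #> fst z, H #> snd z))"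
    unfolding prod_topology_discrete_topology
    using continuous_map_compose[OF fst continuous_map_opened_coset]
      continuous_map_compose[OF snd continuous_map_opened_coset]
    by (simp add: continuous_map_pairwise o_def)
  have disc: "continuous_map (discrete_topology (UNIV \<times> UNIV)) (discrete_topology UNIV) (\<lambda>(A, B). A <#> B)"
    by simp
  show "continuous_map ?P ?X (\<lambda>(x, y). x \<otimes> y)"
  proof (rule continuous_map_opened_topology)
    show "continuous_map ?P X (\<lambda>(x, y). x \<otimes> y)"
      using continuous_map_compose[OF id2 continuous_mult] by (simp add: o_def)
    show "continuous_map ?P (discrete_topology UNIV) (\<lambda>z. H #> (case z of (x, y) \<Rightarrow> x \<otimes> y))"
      by (rule continuous_map_eq[OF continuous_map_compose[OF cos2 disc]])
        (auto simp: H.rcos_sum)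
  qed auto
  have sinv: "continuous_map (discrete_topology UNIV) (discrete_topology UNIV) (\<lambda>A. set_inv A)"
    by simp
  show "continuous_map ?X ?X (\<lambda>x. inv x)"
  proof (rule continuous_map_opened_topology)
    show "continuous_map ?X X (\<lambda>x. inv x)"
      using continuous_map_compose[OF continuous_map_opened_id continuous_inv] by (simp add: o_def)
    show "continuous_map ?X (discrete_topology UNIV) (\<lambda>x. H #> inv x)"
      by (rule continuous_map_eq[OF continuous_map_compose[OF continuous_map_opened_coset sinv]])
        (auto simp: H.rcos_inv)
  qed auto
qed

lemma openin_opened_subgroup:
  assumes H: "subgroup H G"
  shows "openin (opened_topology G X H) H" "closedin (opened_topology G X H) H"
proof -
  interpret H: subgroup H G by fact
  have "{g \<in> carrier G. H #> g \<in> {H}} = H"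
    using H.subset coset_join1[OF _ _ H] coset_join2[OF _ H] by blast
  then show "openin (opened_topology G X H) H" "closedin (opened_topology G X H) H"
    using openin_continuous_map_preimage[OF continuous_map_opened_coset, of "{H}" H]
      closedin_continuous_map_preimage[OF continuous_map_opened_coset, of "{H}" H]
    by auto
qed

lemma subtopology_opened:
  assumes H: "subgroup H G"
  shows "subtopology (opened_topology G X H) H = subtopology X H"
proof -
  interpret H: subgroup H G by fact
  let ?X = "opened_topology G X H"
  have "continuous_map (subtopology X H) (subtopology ?X H) (\<lambda>g. g)"
  proof -
    have "continuous_map (subtopology X H) ?X (\<lambda>g. g)"
    proof (rule continuous_map_opened_topology)
      show "continuous_map (subtopology X H) (discrete_topology UNIV) (\<lambda>z. H #> z)"
        by (rule continuous_map_eq[where f = "\<lambda>_. H"])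
          (use coset_join2[OF _ H] in \<open>auto simp: topspace_eq\<close>)
    qed (auto simp: topspace_eq continuous_map_from_subtopology[OF continuous_map_id, unfolded id_def])
    then show ?thesis
      by (auto simp: continuous_map_in_subtopology)
  qed
  moreover have "continuous_map (subtopology ?X H) (subtopology X H) (\<lambda>g. g)"
    using continuous_map_from_subtopology[OF continuous_map_opened_id, of H H]
    by (auto simp: continuous_map_in_subtopology)
  ultimately have "homeomorphic_map (subtopology ?X H) (subtopology X H) id"
    by (auto simp: homeomorphic_map_maps homeomorphic_maps_def id_def)
  then show ?thesis by simp
qed

end

section \<open>Parities of intersections with finite sets\<close>

text \<open>
  This is the combinatorial reason why the compact sets considered below are finite. The members of
  \<open>B\<close> are chosen with distinct maxima, like the rows of a matrix in echelon form. Hence a set \<open>S\<close> can be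
  built by recursion on \<open>m\<close>, where whether \<open>m\<close> is put into \<open>S\<close> decides the parity of the
  intersection with the member of \<open>B\<close> whose maximum is \<open>m\<close> and affects no member with a smaller maximum.
  Keeping \<open>S\<close> above the finite set \<open>u\<close> leaves only finitely many members of \<open>B\<close> uncontrolled.
\<close>

lemma infinite_even_intersections:
  fixes W :: "nat set set"
  assumes "infinite W" and fin: "\<And>w. w \<in> W \<Longrightarrow> finite w"
  shows "\<exists>B\<subseteq>W. infinite B \<and>
    (\<forall>u. finite u \<longrightarrow> (\<exists>S. even (card (u \<inter> S)) \<and> finite {b \<in> B. even (card (b \<inter> S))}))"
proof -
  have inf: "infinite (Max ` (W - {{}}))"
  proof
    assume "finite (Max ` (W - {{}}))"
    then obtain N where N: "\<And>w. w \<in> W - {{}} \<Longrightarrow> Max w \<le> N"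
      unfolding finite_nat_set_iff_bounded_le by blast
    have "W \<subseteq> Pow {..N}"
    proof
      fix w assume w: "w \<in> W"
      show "w \<in> Pow {..N}"
      proof (cases "w = {}")
        case False
        with w N[of w] show ?thesis
          using Max_ge[OF fin[OF w]] by fastforce
      qed simp
    qed
    with assms(1) show False by (meson finite_Pow_iff finite_atMost finite_subset)
  qed
  define M where "M = Max ` (W - {{}})"
  have "\<forall>m\<in>M. \<exists>w. w \<in> W - {{}} \<and> Max w = m"
    unfolding M_def by blast
  from bchoice[OF this] obtain a where a: "\<And>m. m \<in> M \<Longrightarrow> a m \<in> W - {{}} \<and> Max (a m) = m"
    by blast
  have am: "m \<in> a m" "a m \<subseteq> {..m}" "finite (a m)" if "m \<in> M" for m
  proof -
    show f: "finite (a m)" using a[OF that] fin by blast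
    show "m \<in> a m" "a m \<subseteq> {..m}"
      using a[OF that] Max_in[OF f] Max_ge[OF f] by auto
  qed
  have "inj_on a M"
    by (rule inj_on_inverseI[where g = Max]) (use a in blast)
  then have "infinite (a ` M)"
    using inf finite_imageD unfolding M_def by blast
  moreover have "\<exists>S. even (card (u \<inter> S)) \<and> finite {b \<in> a ` M. even (card (b \<inter> S))}"
    if u: "finite u" for u
  proof -
    obtain N where N: "u \<subseteq> {..<N}"
      using u by (metis finite_nat_bounded)
    (* T m is the part of S below m; the number m is added exactly when the member of B with
       maximum m would otherwise meet S in an even number of points. *)
    define T where "T = rec_nat {} (\<lambda>m A. if N \<le> m \<and> even (card (a m \<inter> A)) then insert m A else A)"
    have T0: "T 0 = {}" and TS: "T (Suc m) = (if N \<le> m \<and> even (card (a m \<inter> T m)) then insert m (T m) else T m)"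
      for m by (auto simp: T_def)
    have Tb: "T m \<subseteq> {N..<m}" for m
      by (induction m) (use T0 TS in \<open>fastforce split: if_splits\<close>)+
    define S where "S = (\<Union>m. T m)"
    have mono: "T m \<subseteq> T n" if "m \<le> n" for m n
      using that by (induction rule: dec_induct) (auto simp: TS)
    have ST: "S \<inter> {..<m} = T m" for m
    proof
      show "T m \<subseteq> S \<inter> {..<m}" using Tb[of m] by (auto simp: S_def)
      have "x \<in> T m" if "x \<in> T n" "x < m" for x n
        using that
      proof (induction n)
        case (Suc n)
        then show ?case
        proof (cases "x \<in> T n")
          case False
          with Suc.prems have "x = n" by (auto simp: TS split: if_splits)
          then show ?thesis using Suc.prems mono[of "Suc n" m] by auto
        qed auto
      qed (simp add: T0)
      then show "S \<inter> {..<m} \<subseteq> T m" by (auto simp: S_def)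
    qed
    have "S \<subseteq> {N..}" using Tb by (force simp: S_def)
    then have "u \<inter> S = {}" using N by fastforce
    then have "even (card (u \<inter> S))" by simp
    moreover have "odd (card (a m \<inter> S))" if m: "m \<in> M" "N \<le> m" for m
    proof -
      have "{..m} = {..<Suc m}" by auto
      then have "a m \<inter> S = a m \<inter> T (Suc m)"
        using am(2)[OF m(1)] ST[of "Suc m"] by blast
      moreover have "m \<notin> T m" using Tb[of m] by auto
      ultimately show ?thesis
        using am(1,3)[OF m(1)] m(2) by (simp add: TS Int_insert_right)
    qed
    then have "{b \<in> a ` M. even (card (b \<inter> S))} \<subseteq> a ` {..<N}"
      by (force simp: not_less[symmetric])
    then have "finite {b \<in> a ` M. even (card (b \<inter> S))}"
      using finite_subset by blast
    ultimately show ?thesis by blast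
  qed
  moreover have "a ` M \<subseteq> W" using a by blast
  ultimately show ?thesis by blast
qed

lemma even_card_sym_diff:
  assumes "finite u" "finite v"
  shows "even (card (sym_diff u v \<inter> S)) \<longleftrightarrow> (even (card (u \<inter> S)) \<longleftrightarrow> even (card (v \<inter> S)))"
proof -
  have "card (u \<inter> S) = card ((u - v) \<inter> S) + card (u \<inter> v \<inter> S)"
    using assms by (subst card_Un_disjoint[symmetric]) (auto intro!: arg_cong[where f = card])
  moreover have "card (v \<inter> S) = card ((v - u) \<inter> S) + card (u \<inter> v \<inter> S)"
    using assms by (subst card_Un_disjoint[symmetric]) (auto intro!: arg_cong[where f = card])
  moreover have "card (sym_diff u v \<inter> S) = card ((u - v) \<inter> S) + card ((v - u) \<inter> S)"
    using assms by (subst card_Un_disjoint[symmetric]) (auto intro!: arg_cong[where f = card])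
  ultimately show ?thesis by auto
qed

section \<open>Divisible groups and their powers\<close>

text \<open>
  The additive group of rationals modulo 1, transported along an injection of the rationals into the
  integers. It is divisible by 2 and has the involution 1/2.
\<close>

lemma ex_two_divisible_int_group:
  "\<exists>(A :: int monoid) t. comm_group A \<and> (\<forall>a\<in>carrier A. \<exists>b\<in>carrier A. b \<otimes>\<^bsub>A\<^esub> b = a) \<and>
     t \<in> carrier A \<and> t \<noteq> \<one>\<^bsub>A\<^esub> \<and> t \<otimes>\<^bsub>A\<^esub> t = \<one>\<^bsub>A\<^esub>"
proof -
  define e :: "rat \<Rightarrow> int" where "e = int \<circ> to_nat"
  have inj: "inj e" by (auto simp: e_def inj_def)
  define d :: "int \<Rightarrow> rat" where "d = from_nat \<circ> nat"
  have de [simp]: "d (e q) = q" for q by (simp add: d_def e_def)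
  define A where "A = \<lparr>carrier = e ` {0..<1}, mult = (\<lambda>a b. e (frac (d a + d b))), one = e 0\<rparr>"
  have "comm_group A"
  proof (rule comm_groupI)
    show "\<exists>y\<in>carrier A. y \<otimes>\<^bsub>A\<^esub> x = \<one>\<^bsub>A\<^esub>" if "x \<in> carrier A" for x
    proof -
      have "x \<in> range e" using that by (auto simp: A_def)
      then obtain q where "x = e q" by blast
      moreover have "frac (frac (- q) + q) = 0"
        by (auto simp: frac_def)
      ultimately show ?thesis
        by (auto simp: A_def frac_lt_1 intro!: bexI[of _ "frac (- q)"])
    qed
    show "x \<otimes>\<^bsub>A\<^esub> y \<otimes>\<^bsub>A\<^esub> z = x \<otimes>\<^bsub>A\<^esub> (y \<otimes>\<^bsub>A\<^esub> z)"
      if "x \<in> carrier A" "y \<in> carrier A" "z \<in> carrier A" for x y z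
    proof -
      have frac_shift: "frac (frac p + r) = frac (p + r)" for p r :: rat
      proof -
        have "frac p + r = (p + r) - of_int \<lfloor>p\<rfloor>" by (simp add: frac_def)
        also have "frac \<dots> = frac (p + r)" unfolding frac_def by (simp add: algebra_simps)
        finally show ?thesis .
      qed
      have "frac (frac (d x + d y) + d z) = frac (d x + frac (d y + d z))"
        using frac_shift[of "d x + d y" "d z"] frac_shift[of "d y + d z" "d x"]
        by (simp add: algebra_simps)
      then show ?thesis by (simp add: A_def)
    qed
  qed (auto simp: A_def frac_lt_1 add.commute frac_eq)
  moreover have "\<exists>b\<in>carrier A. b \<otimes>\<^bsub>A\<^esub> b = a" if "a \<in> carrier A" for a
  proof -
    have "a \<in> e ` {0..<1}" using that by (simp add: A_def)
    then obtain q where "a = e q" "0 \<le> q" "q < 1" by auto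
    then show ?thesis
      by (intro bexI[of _ "e (q / 2)"]) (auto simp: A_def frac_eq)
  qed
  moreover have "e (1/2) \<in> carrier A" "e (1/2) \<noteq> \<one>\<^bsub>A\<^esub>" "e (1/2) \<otimes>\<^bsub>A\<^esub> e (1/2) = \<one>\<^bsub>A\<^esub>"
    using inj by (auto simp: A_def inj_eq frac_def)
  ultimately show ?thesis by blast
qed

definition power_group :: "'a monoid \<Rightarrow> ('i \<Rightarrow> 'a) monoid" where
  "power_group A =
     \<lparr>carrier = (UNIV \<rightarrow>\<^sub>E carrier A), mult = (\<lambda>f g i. f i \<otimes>\<^bsub>A\<^esub> g i), one = (\<lambda>_. \<one>\<^bsub>A\<^esub>)\<rparr>"

definition power_topology :: "'a monoid \<Rightarrow> ('i \<Rightarrow> 'a) topology" where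
  "power_topology A = product_topology (\<lambda>_. discrete_topology (carrier A)) UNIV"

lemma comm_group_power_group:
  assumes "comm_group A"
  shows "comm_group (power_group A)"
proof -
  interpret comm_group A by fact
  show ?thesis
  proof (rule comm_groupI)
    fix x :: "'i \<Rightarrow> 'a" assume "x \<in> carrier (power_group A)"
    then show "\<exists>y\<in>carrier (power_group A). y \<otimes>\<^bsub>power_group A\<^esub> x = \<one>\<^bsub>power_group A\<^esub>"
      by (intro bexI[of _ "\<lambda>i. inv\<^bsub>A\<^esub> x i"]) (auto simp: power_group_def PiE_iff)
  qed (auto simp: power_group_def PiE_iff m_ac)
qed

lemma inv_power_group:
  assumes "comm_group A" "x \<in> carrier (power_group A)"
  shows "inv\<^bsub>power_group A\<^esub> x = (\<lambda>i. inv\<^bsub>A\<^esub> x i)"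
proof -
  interpret comm_group A by fact
  interpret P: comm_group "power_group A" by (rule comm_group_power_group[OF assms(1)])
  show ?thesis
    by (rule P.inv_equality) (use assms(2) in \<open>auto simp: power_group_def PiE_iff\<close>)
qed

lemma topspace_power_topology: "topspace (power_topology A) = carrier (power_group A)"
  by (simp add: power_topology_def power_group_def)

lemma continuous_map_power_topology:
  "continuous_map Z (power_topology A) f \<longleftrightarrow>
     (\<forall>i. continuous_map Z (discrete_topology (carrier A)) (\<lambda>z. f z i))"
  by (simp add: power_topology_def continuous_map_componentwise_UNIV)

lemma continuous_map_power_projection:
  "continuous_map (power_topology A) (discrete_topology (carrier A)) (\<lambda>f. f i)"
  unfolding power_topology_def
  by (rule continuous_map_product_projection[of i UNIV "\<lambda>_. discrete_topology (carrier A)"]) simp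

lemma topological_comm_group_power:
  assumes "comm_group A"
  shows "topological_comm_group (power_group A) (power_topology A :: ('i \<Rightarrow> 'a) topology)"
proof -
  interpret A: comm_group A by fact
  let ?G = "power_group A :: ('i \<Rightarrow> 'a) monoid"
  let ?Y = "power_topology A :: ('i \<Rightarrow> 'a) topology"
  interpret comm_group ?G by (rule comm_group_power_group[OF assms])
  show ?thesis
  proof
    show "topspace ?Y = carrier ?G" by (rule topspace_power_topology)
    show "continuous_map (prod_topology ?Y ?Y) ?Y (\<lambda>(x, y). x \<otimes>\<^bsub>?G\<^esub> y)"
      unfolding continuous_map_power_topology
    proof
      fix i :: 'i
      let ?d = "discrete_topology (carrier A)"
      have "continuous_map (prod_topology ?Y ?Y) (prod_topology ?d ?d) (\<lambda>z. (fst z i, snd z i))"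
        using continuous_map_compose[OF continuous_map_fst continuous_map_power_projection, of A ?Y i]
          continuous_map_compose[OF continuous_map_snd continuous_map_power_projection, of ?Y A i]
        by (simp add: continuous_map_pairwise o_def)
      moreover have "continuous_map (prod_topology ?d ?d) ?d (\<lambda>(a, b). a \<otimes>\<^bsub>A\<^esub> b)"
        unfolding prod_topology_discrete_topology[symmetric] by auto
      ultimately have "continuous_map (prod_topology ?Y ?Y) ?d
          ((\<lambda>(a, b). a \<otimes>\<^bsub>A\<^esub> b) \<circ> (\<lambda>z. (fst z i, snd z i)))"
        by (rule continuous_map_compose)
      then show "continuous_map (prod_topology ?Y ?Y) ?d (\<lambda>z. (case z of (x, y) \<Rightarrow> x \<otimes>\<^bsub>?G\<^esub> y) i)"
        by (rule continuous_map_eq) (auto simp: power_group_def)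
    qed
    show "continuous_map ?Y ?Y (\<lambda>x. inv\<^bsub>?G\<^esub> x)"
      unfolding continuous_map_power_topology
    proof
      fix i :: 'i
      let ?d = "discrete_topology (carrier A)"
      have "continuous_map ?d ?d (\<lambda>a. inv\<^bsub>A\<^esub> a)" by auto
      from continuous_map_compose[OF continuous_map_power_projection this]
      show "continuous_map ?Y ?d (\<lambda>x. (inv\<^bsub>?G\<^esub> x) i)"
        by (rule continuous_map_eq)
          (auto simp: topspace_power_topology inv_power_group[OF assms])
    qed
  qed
qed

section \<open>A subgroup whose compact subsets are finite\<close>

locale group_with_involution = comm_group A for A :: "'a monoid" (structure) +
  fixes t :: 'a
  assumes t_closed: "t \<in> carrier A" and t_neq_one: "t \<noteq> \<one>" and t_square: "t \<otimes> t = \<one>"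
begin

text \<open>
  The cyclic group \<open>{\<one>, t}\<close> of order 2 inside \<open>A\<close> plays the role of the field with two elements.
  The function \<open>parity v\<close> is evaluation at the finite set \<open>v\<close>: it pairs \<open>v\<close>, regarded as an element of
  the vector space of finite sets of naturals under symmetric difference, with all linear functionals
  of that space, which are the sets \<open>S\<close> of naturals. Thus \<open>parities\<close> carries the Bohr topology of that
  vector space, and its closure \<open>H\<close> is the Bohr compactification.
\<close>

definition parity :: "nat set \<Rightarrow> nat set \<Rightarrow> 'a" where
  "parity v = (\<lambda>S. if even (card (v \<inter> S)) then \<one> else t)"

definition parities :: "(nat set \<Rightarrow> 'a) set" where
  "parities = parity ` {v. finite v}"

abbreviation G :: "(nat set \<Rightarrow> 'a) monoid" where "G \<equiv> power_group A"
abbreviation Y :: "(nat set \<Rightarrow> 'a) topology" where "Y \<equiv> power_topology A"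

definition H :: "(nat set \<Rightarrow> 'a) set" where "H = Y closure_of parities"

lemma topological_Y: "topological_comm_group G Y"
  by (rule topological_comm_group_power) (rule comm_group_axioms)

lemma parity_eq_one_iff: "parity v S = \<one> \<longleftrightarrow> even (card (v \<inter> S))"
  using t_neq_one by (simp add: parity_def)

lemma parity_mult:
  assumes "finite u" "finite v"
  shows "parity u \<otimes>\<^bsub>G\<^esub> parity v = parity (sym_diff u v)"
  using even_card_sym_diff[OF assms] t_closed t_square
  by (auto simp: power_group_def parity_def fun_eq_iff)

lemma parities_subset: "parities \<subseteq> UNIV \<rightarrow>\<^sub>E {\<one>, t}"
  by (auto simp: parities_def parity_def)

lemma PiE_subset_carrier: "UNIV \<rightarrow>\<^sub>E {\<one>, t} \<subseteq> carrier G"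
  using t_closed unfolding power_group_def by (simp add: PiE_mono)

lemma involution:
  assumes "f \<in> UNIV \<rightarrow>\<^sub>E {\<one>, t}"
  shows "f \<otimes>\<^bsub>G\<^esub> f = \<one>\<^bsub>G\<^esub>"
proof -
  have "f i \<otimes> f i = \<one>" for i
    using PiE_mem[OF assms, of i] t_square by auto
  then show ?thesis by (simp add: power_group_def)
qed

lemma subgroup_parities: "subgroup parities G"
proof -
  interpret G: comm_group G by (rule comm_group_power_group) (rule comm_group_axioms)
  show ?thesis
  proof (rule G.subgroupI)
    show sub: "parities \<subseteq> carrier G"
      using parities_subset PiE_subset_carrier by blast
    show "parities \<noteq> {}" by (auto simp: parities_def)
    show "f \<otimes>\<^bsub>G\<^esub> g \<in> parities" if "f \<in> parities" "g \<in> parities" for f g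
      using that parity_mult by (auto simp: parities_def)
    show "inv\<^bsub>G\<^esub> f \<in> parities" if "f \<in> parities" for f
    proof -
      have "f \<otimes>\<^bsub>G\<^esub> f = \<one>\<^bsub>G\<^esub>" using that parities_subset involution by blast
      then have "inv\<^bsub>G\<^esub> f = f" using that sub by (intro G.inv_equality) auto
      with that show ?thesis by simp
    qed
  qed
qed

lemma subgroup_H: "subgroup H G"
  unfolding H_def
  by (rule topological_comm_group.subgroup_closure_of[OF topological_Y subgroup_parities])

lemma compactin_PiE_involution: "compactin Y (UNIV \<rightarrow>\<^sub>E {\<one>, t})"
  using t_closed by (simp add: power_topology_def compactin_PiE compactin_discrete_topology)

lemma H_subset: "H \<subseteq> UNIV \<rightarrow>\<^sub>E {\<one>, t}"
  unfolding H_def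
  by (rule closure_of_minimal[OF parities_subset])
    (use t_closed in \<open>simp add: power_topology_def closedin_product_topology\<close>)

lemma parities_subset_H: "parities \<subseteq> H"
  unfolding H_def
  using subgroup.subset[OF subgroup_parities] by (simp add: closure_of_subset topspace_power_topology)

lemma compactin_H: "compactin Y H"
  by (rule closed_compactin[OF compactin_PiE_involution H_subset]) (simp add: H_def)

text \<open>
  An infinite compact set \<open>K\<close> of parities would contain the parities of an infinite family \<open>B\<close> as in
  \<open>infinite_even_intersections\<close>. For suitable sets \<open>S\<close>, the open conditions "the coordinate at \<open>S\<close> is
  trivial" cover \<open>K\<close>, but each holds for only finitely many members of \<open>B\<close>, so there is no finite
  subcover.
\<close>

lemma finite_if_compactin_parities:
  assumes K: "compactin Y K" and sub: "K \<subseteq> parities"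
  shows "finite K"
proof (rule ccontr)
  assume inf: "infinite K"
  define W where "W = {v. finite v \<and> parity v \<in> K}"
  have "K \<subseteq> parity ` W" using sub by (auto simp: W_def parities_def)
  then have "infinite W" using inf finite_surj by blast
  from infinite_even_intersections[OF this]
  have "\<exists>B\<subseteq>W. infinite B \<and>
      (\<forall>u. finite u \<longrightarrow> (\<exists>S. even (card (u \<inter> S)) \<and> finite {b \<in> B. even (card (b \<inter> S))}))"
    by (simp add: W_def)
  then obtain B where B: "B \<subseteq> W" "infinite B"
    and Bev: "\<forall>u. finite u \<longrightarrow> (\<exists>S. even (card (u \<inter> S)) \<and> finite {b \<in> B. even (card (b \<inter> S))})"
    by blast
  define N where "N = (\<lambda>S. {f \<in> carrier G. f S = \<one>})"
  define \<S> where "\<S> = {S. finite {b \<in> B. even (card (b \<inter> S))}}"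
  have N_open: "openin Y (N S)" for S
  proof -
    have "openin Y {f \<in> topspace Y. f S \<in> {\<one>}}"
      by (rule openin_continuous_map_preimage[OF continuous_map_power_projection]) simp
    then show ?thesis by (simp add: N_def topspace_power_topology)
  qed
  have "K \<subseteq> \<Union>(N ` \<S>)"
  proof
    fix f assume "f \<in> K"
    then have "f \<in> parities" using sub by blast
    then have fc: "f \<in> carrier G" using subgroup.subset[OF subgroup_parities] by blast
    obtain u where u: "finite u" "f = parity u"
      using \<open>f \<in> parities\<close> by (auto simp: parities_def)
    obtain S where "even (card (u \<inter> S))" "S \<in> \<S>"
      using Bev u(1) unfolding \<S>_def by blast
    then show "f \<in> \<Union>(N ` \<S>)"
      using fc by (auto simp: N_def u(2) parity_eq_one_iff)
  qed
  moreover have "\<forall>U\<in>N ` \<S>. openin Y U" using N_open by blast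
  ultimately have "\<exists>\<F>. finite \<F> \<and> \<F> \<subseteq> N ` \<S> \<and> K \<subseteq> \<Union>\<F>"
    using K unfolding compactin_def by blast
  then obtain F where F: "finite F" "F \<subseteq> \<S>" "K \<subseteq> \<Union>(N ` F)"
    by (metis (no_types, lifting) finite_subset_image)
  have "B \<subseteq> (\<Union>S\<in>F. {b \<in> B. even (card (b \<inter> S))})"
  proof
    fix b assume b: "b \<in> B"
    then have "parity b \<in> K" using B by (auto simp: W_def)
    then obtain S where "S \<in> F" "parity b S = \<one>"
      using F(3) by (auto simp: N_def)
    with b show "b \<in> (\<Union>S\<in>F. {b \<in> B. even (card (b \<inter> S))})"
      by (auto simp: parity_eq_one_iff)
  qed
  moreover have "finite (\<Union>S\<in>F. {b \<in> B. even (card (b \<inter> S))})"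
    using F by (auto simp: \<S>_def)
  ultimately show False using B(2) finite_subset by blast
qed

text \<open>
  A basic neighbourhood of the identity restricts finitely many coordinates \<open>S\<close>. By the pigeonhole
  principle two numbers \<open>m\<close> and \<open>n\<close> belong to the same ones among these \<open>S\<close>, and then \<open>{m, n}\<close> has
  trivial parity at all of them.
\<close>

lemma one_not_isolated:
  assumes U: "openin Y U" "\<one>\<^bsub>G\<^esub> \<in> U"
  shows "\<exists>f\<in>parities. f \<in> U \<and> f \<noteq> \<one>\<^bsub>G\<^esub>"
proof -
  obtain X where X: "\<one>\<^bsub>G\<^esub> \<in> (\<Pi>\<^sub>E S\<in>UNIV. X S)"
      "finite {S. X S \<noteq> carrier A}" "(\<Pi>\<^sub>E S\<in>UNIV. X S) \<subseteq> U"
    using product_topology_open_contains_basis[OF U[unfolded power_topology_def]] by auto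
  define F where "F = {S. X S \<noteq> carrier A}"
  have "finite ((\<lambda>n. {S \<in> F. n \<in> S}) ` (UNIV :: nat set))"
    by (rule finite_subset[of _ "Pow F"]) (use X(2) in \<open>auto simp: F_def\<close>)
  then have "\<not> inj (\<lambda>n::nat. {S \<in> F. n \<in> S})"
    using finite_imageD infinite_UNIV_nat by blast
  then obtain m n :: nat where mn: "m \<noteq> n" "{S \<in> F. m \<in> S} = {S \<in> F. n \<in> S}"
    by (auto simp: inj_def)
  let ?f = "parity {m, n}"
  have fin: "?f \<in> parities" by (auto simp: parities_def)
  have "?f S \<in> X S" for S
  proof (cases "S \<in> F")
    case True
    have "{m, n} \<inter> S = (if m \<in> S then {m, n} else {})"
      using mn(2) True by auto
    then have "?f S = \<one>" using mn(1) by (auto simp: parity_def)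
    then show ?thesis using X(1) by (auto simp: power_group_def PiE_iff)
  next
    case False
    then show ?thesis using t_closed by (auto simp: F_def parity_def)
  qed
  then have "?f \<in> U" using X(3) by auto
  moreover have "{m, n} \<inter> {m} = {m}" by auto
  then have "?f {m} \<noteq> \<one>" using t_neq_one by (simp add: parity_def)
  then have "?f \<noteq> \<one>\<^bsub>G\<^esub>" by (auto simp: power_group_def)
  ultimately show ?thesis using fin by blast
qed

text \<open>
  In a metrizable space a point that is not isolated is the limit of a sequence avoiding it, which
  gives an infinite compact set.
\<close>

lemma not_metrizable_parities: "\<not> metrizable_space (subtopology Y parities)"
proof
  let ?Z = "subtopology Y parities"
  assume "metrizable_space ?Z"
  then obtain M d where "Metric_space M d" and Z: "?Z = Metric_space.mtopology M d"
    unfolding metrizable_space_def by blast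
  interpret Metric_space M d by fact
  let ?D = "parities - {\<one>\<^bsub>G\<^esub>}"
  have one: "\<one>\<^bsub>G\<^esub> \<in> parities" using subgroup.one_closed[OF subgroup_parities] .
  have sub: "parities \<subseteq> carrier G" using subgroup.subset[OF subgroup_parities] .
  have tsp: "topspace ?Z = parities" using sub by (auto simp: topspace_power_topology)
  have "\<exists>f. f \<in> ?D \<and> f \<in> T" if T: "\<one>\<^bsub>G\<^esub> \<in> T" "openin ?Z T" for T
  proof -
    obtain U where "openin Y U" "T = U \<inter> parities"
      using T(2) by (auto simp: openin_subtopology)
    with one_not_isolated[of U] T(1) show ?thesis by blast
  qed
  then have "\<one>\<^bsub>G\<^esub> \<in> ?Z closure_of ?D"
    using one tsp by (simp add: in_closure_of)
  then obtain \<sigma> where \<sigma>: "range \<sigma> \<subseteq> ?D" "limitin ?Z \<sigma> \<one>\<^bsub>G\<^esub> sequentially"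
    unfolding Z closure_of_sequentially by blast
  have "compactin ?Z (insert \<one>\<^bsub>G\<^esub> (range \<sigma>))"
    by (rule compactin_sequence_with_limit[OF \<sigma>(2)]) (use \<sigma>(1) tsp in auto)
  then have "finite (insert \<one>\<^bsub>G\<^esub> (range \<sigma>))"
    by (intro finite_if_compactin_parities) (auto simp: compactin_subtopology)
  then have "closedin ?Z (range \<sigma>)"
    using \<sigma>(1) Hausdorff_space_mtopology Z tsp by (intro closedin_Hausdorff_finite) fastforce+
  then have "\<one>\<^bsub>G\<^esub> \<in> range \<sigma>"
    using limitin_closedin[OF \<sigma>(2)] by (simp add: trivial_limit_sequentially)
  with \<sigma>(1) show False by blast
qed

end

section \<open>Characters and the failure of determination\<close>

text \<open>
  When all compact sets are finite, the compact-open topology is no finer than the topology of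
  pointwise convergence.
\<close>

lemma dual_topology_pointwise:
  assumes fin: "\<And>K. compactin X K \<Longrightarrow> finite K"
    and "openin (dual_topology G X) W" "g \<in> W"
  shows "\<exists>C. finite C \<and> C \<subseteq> topspace X \<and>
           (\<forall>h\<in>carrier (dual_group G X). (\<forall>x\<in>C. h x = g x) \<longrightarrow> h \<in> W)"
proof -
  have "generate_topology_on
      {{h \<in> carrier (dual_group G X). h ` K \<subseteq> U} | K U.
          compactin X K \<and> openin circle_topology U} W"
    using assms(2) by (simp add: dual_topology_def openin_topology_generated_by_iff)
  then show ?thesis using assms(3)
  proof (induction rule: generate_topology_on.induct)
    case (Int a b)
    then have "g \<in> a" "g \<in> b" by simp_all
    from Int.IH(1)[OF this(1)] obtain C1 where C1: "finite C1" "C1 \<subseteq> topspace X"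
      "\<forall>h\<in>carrier (dual_group G X). (\<forall>x\<in>C1. h x = g x) \<longrightarrow> h \<in> a"
      by (elim exE conjE)
    from Int.IH(2)[OF \<open>g \<in> b\<close>] obtain C2 where C2: "finite C2" "C2 \<subseteq> topspace X"
      "\<forall>h\<in>carrier (dual_group G X). (\<forall>x\<in>C2. h x = g x) \<longrightarrow> h \<in> b"
      by (elim exE conjE)
    show ?case
      by (rule exI[of _ "C1 \<union> C2"]) (use C1 C2 in simp)
  next
    case (UN \<K>)
    then obtain k where k: "k \<in> \<K>" "g \<in> k" by (elim UnionE)
    from UN.IH[OF this] obtain C where C: "finite C" "C \<subseteq> topspace X"
      "\<forall>h\<in>carrier (dual_group G X). (\<forall>x\<in>C. h x = g x) \<longrightarrow> h \<in> k"
      by (elim exE conjE)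
    show ?case
      by (rule exI[of _ C]) (use C k(1) in auto)
  next
    case (Basis s)
    then obtain K U where K: "compactin X K" and s: "s = {h \<in> carrier (dual_group G X). h ` K \<subseteq> U}"
      by blast
    have "h \<in> s" if "h \<in> carrier (dual_group G X)" "\<forall>x\<in>K. h x = g x" for h
      using that \<open>g \<in> s\<close> by (auto simp: s)
    then show ?case
      by (intro exI[of _ K] conjI ballI impI fin[OF K] compactin_subset_topspace[OF K])
  qed simp
qed

lemma topspace_circle_topology: "topspace circle_topology = {-1/2<..1/2}"
  by (simp add: circle_topology_def topspace_pullback_topology)

text \<open>
  The point 1/2 is the only one sent to -1 by the map onto the unit circle. Its complement is a
  neighbourhood of 0 that contains no element of order 2.
\<close>

lemma openin_circle_minus_half: "openin circle_topology ({-1/2<..1/2} - {1/2})"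
proof -
  have "cis (2 * pi * x) = -1 \<longleftrightarrow> x = 1/2" if "x \<in> {-1/2<..1/2}" for x :: real
  proof
    assume "cis (2 * pi * x) = -1"
    then have "cos (2 * pi * x) = -1" by (metis cis.sel(1) one_complex.sel(1) uminus_complex.sel(1))
    then have c: "cos \<bar>2 * pi * x\<bar> = cos pi" by simp
    have "\<bar>2 * pi * x\<bar> \<le> pi"
    proof -
      have "\<bar>2 * x\<bar> \<le> 1" using that by auto
      then have "pi * \<bar>2 * x\<bar> \<le> pi" by (rule mult_left_le) simp
      then show ?thesis by (simp add: abs_mult mult_ac)
    qed
    then have "\<bar>2 * pi * x\<bar> = pi"
      using cos_inj_pi[OF _ _ _ _ c] by simp
    then have "\<bar>x\<bar> = 1/2" by (simp add: abs_mult)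
    with that show "x = 1/2" by (auto simp: abs_if split: if_splits)
  next
    assume "x = 1/2"
    then have eq: "2 * pi * x = pi" by simp
    show "cis (2 * pi * x) = -1" unfolding eq by simp
  qed
  then have "(\<lambda>x. cis (2 * pi * x)) -` (- {-1}) \<inter> {-1/2<..1/2} = {-1/2<..1/2} - {1/2 :: real}"
    by auto
  moreover have "open (- {-1} :: complex set)" by (rule open_Compl) simp
  ultimately show ?thesis
    unfolding circle_topology_def openin_pullback_topology by (metis open_openin)
qed

lemma circle_rep_half_sums: "circle_rep 0 = 0" "circle_rep (1/2) = 1/2" "circle_rep 1 = 0"
  by (simp_all add: circle_rep_def ceiling_eq_iff[of _ 0, simplified] ceiling_eq_iff[of _ 1, simplified])

lemma circle_rep_double_eq_zero:
  assumes "x \<in> {-1/2<..1/2}" "circle_rep (x + x) = 0"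
  shows "x = 0 \<or> x = 1/2"
proof -
  define k where "k = \<lceil>x + x - 1/2\<rceil>"
  have "2 * x = of_int k"
    using assms(2) by (simp add: circle_rep_def k_def)
  moreover from this have "k = 0 \<or> k = 1" using assms(1) by auto
  ultimately show ?thesis by auto
qed

lemma character_value_at_involution:
  fixes G (structure)
  assumes h: "h \<in> hom G circle_group" and x: "x \<in> carrier G" "x \<otimes> x = \<one>" and G: "group G"
  shows "h x = 0 \<or> h x = 1/2"
proof -
  interpret group G by fact
  have hx: "h y \<in> {-1/2<..1/2}" if "y \<in> carrier G" for y
    using h that by (auto simp: hom_def circle_group_def)
  have hm: "h (y \<otimes> z) = circle_rep (h y + h z)" if "y \<in> carrier G" "z \<in> carrier G" for y z
    using h that by (auto simp: hom_def circle_group_def)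
  have "h \<one> = circle_rep (h \<one> + h \<one>)" using hm[of \<one> \<one>] by simp
  (* The value at the identity is an integer in (-1/2, 1/2]. *)
  then have "h \<one> = of_int \<lceil>h \<one> + h \<one> - 1/2\<rceil>" by (simp add: circle_rep_def)
  then obtain k :: int where k: "h \<one> = of_int k" by blast
  with hx[of \<one>] have "h \<one> = 0" by auto
  then show ?thesis
    using circle_rep_double_eq_zero[OF hx[OF x(1)]] hm[OF x(1) x(1)] x(2) by simp
qed

context group_with_involution
begin

lemma coordinate_character:
  "(\<lambda>f\<in>parities. if f S = \<one> then 0 else 1/2)
     \<in> carrier (dual_group (subgroup_of G parities) (subtopology Y parities))" (is "?\<chi> \<in> _")
proof -
  let ?d = "discrete_topology (carrier A)"
  have val: "f S = \<one> \<or> f S = t" if "f \<in> parities" for f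
    using that by (auto simp: parities_def parity_def)
  have mem: "f \<otimes>\<^bsub>G\<^esub> g \<in> parities" if "f \<in> parities" "g \<in> parities" for f g
    using subgroup.m_closed[OF subgroup_parities that] .
  have "?\<chi> \<in> hom (subgroup_of G parities) circle_group"
  proof (rule homI)
    show "?\<chi> (f \<otimes>\<^bsub>subgroup_of G parities\<^esub> g) = ?\<chi> f \<otimes>\<^bsub>circle_group\<^esub> ?\<chi> g"
      if "f \<in> carrier (subgroup_of G parities)" "g \<in> carrier (subgroup_of G parities)" for f g
    proof -
      have fg: "f \<in> parities" "g \<in> parities" using that by auto
      have "(f \<otimes>\<^bsub>G\<^esub> g) S = f S \<otimes> g S" by (simp add: power_group_def)
      then show ?thesis
        using fg mem[OF fg] val[OF fg(1)] val[OF fg(2)] t_closed t_square t_neq_one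
        by (auto simp: circle_group_def circle_rep_half_sums)
    qed
  qed (auto simp: circle_group_def)
  moreover have "continuous_map (subtopology Y parities) circle_topology ?\<chi>"
  proof -
    have "continuous_map (subtopology Y parities) ?d (\<lambda>f. f S)"
      by (rule continuous_map_from_subtopology[OF continuous_map_power_projection])
    moreover have "continuous_map ?d circle_topology (\<lambda>a. if a = \<one> then 0 else 1/2)"
      by (auto simp: topspace_circle_topology)
    ultimately have "continuous_map (subtopology Y parities) circle_topology
        ((\<lambda>a. if a = \<one> then 0 else 1/2) \<circ> (\<lambda>f. f S))"
      by (rule continuous_map_compose)
    then show ?thesis by (rule continuous_map_eq) auto
  qed
  ultimately show ?thesis by (simp add: dual_group_def)
qed

text \<open>
  The dense subgroup \<open>parities\<close> does not determine \<open>H\<close>. Since \<open>H\<close> is compact of exponent 2, the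
  characters of \<open>H\<close> that omit the value 1/2 form an open set, which contains the trivial character only.
  If restriction were a homeomorphism, the trivial character of \<open>parities\<close> would be isolated as well. But
  compact subsets of \<open>parities\<close> are finite, so a neighbourhood of the trivial character only restricts
  the values at the parities of finitely many finite sets, and the coordinate at \<open>{n}\<close> is a nontrivial
  character that vanishes there as soon as \<open>n\<close> lies in none of these sets.
\<close>

lemma H_not_determined: "\<not> determined (subgroup_of G H) (subtopology Y H)"
proof
  let ?K = "subgroup_of G H" and ?Z = "subtopology Y H"
  let ?K' = "subgroup_of G parities" and ?Z' = "subtopology Y parities"
  assume det: "determined ?K ?Z"
  interpret G: comm_group G by (rule comm_group_power_group) (rule comm_group_axioms)
  have Hc: "H \<subseteq> carrier G" using subgroup.subset[OF subgroup_H] .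
  have tZ: "topspace ?Z = H" using Hc by (auto simp: topspace_power_topology)
  have "subgroup parities ?K"
    by (rule G.subgroup_incl[OF subgroup_parities subgroup_H parities_subset_H])
  moreover have "?Z closure_of parities = topspace ?Z"
    unfolding tZ using parities_subset_H
    by (simp add: closure_of_subtopology Int_absorb1 H_def)
  ultimately have "determines parities ?K ?Z"
    using det unfolding determined_def by blast
  moreover have "subtopology ?Z parities = ?Z'"
    using parities_subset_H by (simp add: subtopology_subtopology Int_absorb1)
  ultimately have homeo:
    "homeomorphic_map (dual_topology ?K ?Z) (dual_topology ?K' ?Z') (\<lambda>h. restrict h parities)"
    unfolding determines_def by simp
  let ?U = "{h \<in> carrier (dual_group ?K ?Z). h ` H \<subseteq> {-1/2<..1/2} - {1/2}}"
  have "compactin ?Z H" using compactin_H by (simp add: compactin_subtopology)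
  then have "openin (dual_topology ?K ?Z) ?U"
    unfolding dual_topology_def using openin_circle_minus_half
    by (intro topology_generated_by_Basis) blast
  then have op: "openin (dual_topology ?K' ?Z') ((\<lambda>h. restrict h parities) ` ?U)"
    using homeomorphic_imp_open_map[OF homeo] unfolding open_map_def by blast
  have zero: "h f = 0" if h: "h \<in> ?U" and f: "f \<in> H" for h f
  proof -
    have "h \<in> hom ?K circle_group" using h by (simp add: dual_group_def)
    moreover have "f \<otimes>\<^bsub>?K\<^esub> f = \<one>\<^bsub>?K\<^esub>" using f H_subset involution by auto
    ultimately have "h f = 0 \<or> h f = 1/2"
      using character_value_at_involution[of h ?K f] f
        subgroup.subgroup_is_group[OF subgroup_H G.group_axioms] by simp
    moreover have "h f \<noteq> 1/2" using h f by blast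
    ultimately show ?thesis by blast
  qed
  let ?z = "\<lambda>f\<in>H. 0 :: real"
  have "?z \<in> hom ?K circle_group"
    using subgroup.m_closed[OF subgroup_H]
    by (auto simp: hom_def circle_group_def circle_rep_half_sums)
  moreover have "continuous_map ?Z circle_topology ?z"
    by (rule continuous_map_eq[where f = "\<lambda>_. 0"]) (auto simp: topspace_circle_topology)
  ultimately have "?z \<in> ?U" by (auto simp: dual_group_def)
  then have mem: "restrict ?z parities \<in> (\<lambda>h. restrict h parities) ` ?U" by (rule imageI)
  have fin: "finite K" if "compactin ?Z' K" for K
    using that finite_if_compactin_parities by (simp add: compactin_subtopology)
  have "\<exists>C. finite C \<and> C \<subseteq> topspace ?Z' \<and>
      (\<forall>h\<in>carrier (dual_group ?K' ?Z'). (\<forall>f\<in>C. h f = restrict ?z parities f)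
        \<longrightarrow> h \<in> (\<lambda>h. restrict h parities) ` ?U)"
    by (rule dual_topology_pointwise[OF _ op mem]) (rule fin)
  then obtain C where C: "finite C" "C \<subseteq> topspace ?Z'"
    and Cin: "\<forall>h\<in>carrier (dual_group ?K' ?Z'). (\<forall>f\<in>C. h f = restrict ?z parities f)
        \<longrightarrow> h \<in> (\<lambda>h. restrict h parities) ` ?U"
    by (elim exE conjE)
  have "C \<subseteq> parity ` {v. finite v}" using C(2) by (auto simp: parities_def)
  then obtain V where V: "finite V" "V \<subseteq> {v. finite v}" "C = parity ` V"
    using C(1) by (meson finite_subset_image)
  have "finite (\<Union>V)" using V by auto
  then obtain n where n: "n \<notin> \<Union>V" using ex_new_if_finite[OF infinite_UNIV_nat] by blast
  let ?\<chi> = "\<lambda>f\<in>parities. if f {n} = \<one> then 0 else 1/2 :: real"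
  have "?\<chi> f = restrict ?z parities f" if f: "f \<in> C" for f
  proof -
    obtain v where v: "v \<in> V" "finite v" "f = parity v" using f V by blast
    then have "v \<inter> {n} = {}" using n by blast
    then have "f {n} = \<one>" using v by (simp add: parity_def)
    moreover have "f \<in> parities" using v by (simp add: parities_def)
    ultimately show ?thesis using parities_subset_H by auto
  qed
  then have "?\<chi> \<in> (\<lambda>h. restrict h parities) ` ?U"
    using Cin[rule_format, OF coordinate_character] by simp
  then obtain h where h: "?\<chi> = restrict h parities" "h \<in> ?U" by (rule imageE)
  have p: "parity {n} \<in> parities" by (simp add: parities_def)
  have "?\<chi> (parity {n}) = h (parity {n})"
    using fun_cong[OF h(1), of "parity {n}"] p by simp
  also have "\<dots> = 0"
    using zero[OF h(2)] p parities_subset_H by blast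
  finally have "?\<chi> (parity {n}) = 0" .
  moreover have "?\<chi> (parity {n}) = 1/2"
    using p t_neq_one by (simp add: parity_def)
  ultimately show False by simp
qed

end

section \<open>The group with the open subgroup\<close>

context group_with_involution
begin

lemma infinite_carrier: "infinite (carrier G)"
proof
  assume "finite (carrier G)"
  moreover have "range (\<lambda>n. parity {n}) \<subseteq> carrier G"
    using subgroup.subset[OF subgroup_parities] by (auto simp: parities_def)
  ultimately have "finite (range (\<lambda>n. parity {n}))" using finite_subset by blast
  moreover have "inj (\<lambda>n. parity {n})"
  proof (rule injI)
    fix m n assume "parity {m} = parity {n}"
    then have "parity {m} {n} = parity {n} {n}" by simp
    then show "m = n" using t_neq_one by (cases "m = n") (auto simp: parity_def)
  qed
  ultimately show False using finite_imageD infinite_UNIV_nat by blast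
qed

text \<open>
  Opening up \<open>H\<close> in the full power of \<open>A\<close> gives the group that witnesses both parts of the theorem.
\<close>

abbreviation X :: "(nat set \<Rightarrow> 'a) topology" where "X \<equiv> opened_topology G Y H"

lemma topological_X: "topological_comm_group G X"
  by (rule topological_comm_group_opened[OF topological_Y subgroup_H])

lemmas openin_H = openin_opened_subgroup(1)[OF topological_Y subgroup_H]
lemmas closedin_H = openin_opened_subgroup(2)[OF topological_Y subgroup_H]
lemmas subtopology_X_H = subtopology_opened[OF topological_Y subgroup_H]

lemma square_H: "h \<in> H \<Longrightarrow> h \<otimes>\<^bsub>G\<^esub> h = \<one>\<^bsub>G\<^esub>"
  using H_subset involution by blast

lemma Hausdorff_X: "Hausdorff_space X"
proof (rule Hausdorff_space_expansive)
  show "Hausdorff_space Y"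
    by (simp add: power_topology_def Hausdorff_space_product_topology)
  show "topspace Y = topspace X"
    using topspace_opened[OF topological_Y] by (simp add: topspace_power_topology)
  show "openin X U" if "openin Y U" for U
    by (rule opened_topology_finer[OF topological_Y that])
qed

lemma locally_bounded_X: "locally_bounded_group G X"
proof -
  have "compactin (subtopology X H) H"
    using compactin_H by (simp add: subtopology_X_H compactin_subtopology)
  then have "bounded_in G X H"
    by (intro compactin_imp_bounded_in[OF topological_X]) (simp add: compactin_subtopology)
  moreover have "H \<noteq> {}" using subgroup.one_closed[OF subgroup_H] by blast
  ultimately show ?thesis
    unfolding locally_bounded_group_def using openin_H by blast
qed

lemma not_metrizable_X: "\<not> metrizable_space X"
proof
  assume "metrizable_space X"
  then have "metrizable_space (subtopology (subtopology X H) parities)"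
    by (intro metrizable_space_subtopology)
  then have "metrizable_space (subtopology Y parities)"
    using parities_subset_H by (simp add: subtopology_X_H subtopology_subtopology Int_absorb1)
  with not_metrizable_parities show False by blast
qed

lemma power_square_root:
  assumes "\<And>a. a \<in> carrier A \<Longrightarrow> \<exists>b\<in>carrier A. b \<otimes> b = a"
    and "g \<in> carrier G"
  shows "\<exists>f\<in>carrier G. f \<otimes>\<^bsub>G\<^esub> f = g"
proof -
  have "\<exists>b. b \<in> carrier A \<and> b \<otimes> b = g i" for i
    using assms by (auto simp: power_group_def PiE_iff)
  then obtain f where "\<And>i. f i \<in> carrier A \<and> f i \<otimes> f i = g i" by metis
  then show ?thesis by (intro bexI[of _ f]) (auto simp: power_group_def)
qed

end

theorem theorem3p5:
  shows "(\<exists>(G :: (nat set \<Rightarrow> int) monoid) X H.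
            topological_comm_group G X \<and> determined G X \<and>
            subgroup H G \<and> openin X H \<and> closedin X H \<and>
            \<not> determined (subgroup_of G H) (subtopology X H))
       \<and> (\<exists>(G :: (nat set \<Rightarrow> int) monoid) X.
            topological_comm_group G X \<and> Hausdorff_space X \<and> locally_bounded_group G X \<and>
            \<not> totally_bounded_group G X \<and> \<not> metrizable_space X \<and> determined G X)"
proof -
  obtain A :: "int monoid" and t where A: "comm_group A"
    and root: "\<forall>a\<in>carrier A. \<exists>b\<in>carrier A. b \<otimes>\<^bsub>A\<^esub> b = a"
    and t: "t \<in> carrier A" "t \<noteq> \<one>\<^bsub>A\<^esub>" "t \<otimes>\<^bsub>A\<^esub> t = \<one>\<^bsub>A\<^esub>"
    using ex_two_divisible_int_group by blast
  interpret group_with_involution A t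
    using A t by (simp add: group_with_involution_def group_with_involution_axioms_def)
  have roots: "\<exists>f\<in>carrier G. f \<otimes>\<^bsub>G\<^esub> f = g" if "g \<in> carrier G" for g
    using power_square_root root that by blast
  have det: "determined G X"
    by (rule determined_if_open_subgroup_of_involutions[OF topological_X openin_H subgroup_H square_H roots])
  have ntb: "\<not> totally_bounded_group G X"
    by (rule not_totally_bounded_if_open_subgroup_of_involutions
        [OF topological_X openin_H subgroup_H square_H roots infinite_carrier])
  have nd: "\<not> determined (subgroup_of G H) (subtopology X H)"
    using H_not_determined by (simp add: subtopology_X_H)
  have a: "topological_comm_group G X \<and> determined G X \<and> subgroup H G \<and> openin X H \<and>
      closedin X H \<and> \<not> determined (subgroup_of G H) (subtopology X H)"
    using topological_X det subgroup_H openin_H closedin_H nd by simp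
  have b: "topological_comm_group G X \<and> Hausdorff_space X \<and> locally_bounded_group G X \<and>
      \<not> totally_bounded_group G X \<and> \<not> metrizable_space X \<and> determined G X"
    using topological_X Hausdorff_X locally_bounded_X ntb not_metrizable_X det by simp
  show ?thesis
    by (rule conjI, rule exI, rule exI, rule exI, rule a, rule exI, rule exI, rule b)
qed

end
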